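(* Let $X\subseteq\mathcal A^{\mathbb Z}$ be an irreducible vertex shift, let $\mathfrak s\in\mathcal A$, let $\varphi$ be the distinguished symbol rule, and let $\mathcal K=\mathcal K(\mathfrak s)\subseteq\mathbb N_{>0}$ be the set of all $k\ge 1$ for which there is a word $w_0w_1\cdots w_k\in\mathcal L_{k+1}(X)$ with $w_0=w_k=\mathfrak s$ and $w_j\neq\mathfrak s$ for all $0<j<k$. Let $\mathcal K^{\mathsf c}=\mathbb N_{>0}\setminus\mathcal K$. Then the transversal and orbital generating functions of the set $\varphi(\mathcal L(X,\mathfrak s))$ of integer compositions (musical scales) decompose, as formal power series, as $$\dim_{\mathsf T}^{\varphi(X,\mathfrak s)}(z)=W^{\mathcal K}(z)+a^{\mathcal K}(z),\qquad \dim_{\mathsf O}^{\varphi(X,\mathfrak s)}(z)=C^{\mathcal K}(z)+b^{\mathcal K}(z),$$ where: 1. $C^{\mathcal K}(z)$ and $W^{\mathcal K}(z)$ are the ordinary generating functions of integer compositions with all summands in $\mathcal K$ and of wheels (cyclic compositions) with all summands in $\mathcal K$, respectively. 2. $a^{\mathcal K}(z)=\sum_{n\ge1}a_n^{\mathcal K}z^n$ is the ordinary generating function of the class $\mathcal D$ of all nonempty compositions $(k_1,\dots,k_r)$ with $k_1,\dots,k_{r-1}\in\mathcal K$, $k_r\in\mathcal K^{\mathsf c}$, and $k_r<k'$ for some $k'\in\mathcal K$; every composition in $\mathcal D$ is aperiodic, and $$a_n^{\mathcal K}=\sum_{\substack{k\in\mathcal K^{\mathsf c},\ k\le n\\ \exists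 k'\in\mathcal K,\ k'>k}}C_{n-k}^{\mathcal K}.$$ 3. $b^{\mathcal K}(z)=\sum_{n\ge1}b_n^{\mathcal K}z^n$ is the orbital generating function of $\mathcal D$, i.e. $b_n^{\mathcal K}=\dim_{\mathsf O}(\mathcal D_n)$ where $\mathcal D_n$ is the set of compositions of $n$ in $\mathcal D$; and it equals the cumulative generating function of $\mathcal D$ with respect to the number of summands (number of notes), i.e. $$b^{\mathcal K}(z)=\left.\frac{\partial}{\partial u}a^{\mathcal K}(z,u)\right|_{u=1},\qquad a^{\mathcal K}(z,u)=\sum_{n,m\ge1}a^{\mathcal K}_{n,m}z^nu^m,$$ where $a^{\mathcal K}_{n,m}$ is the number of elements of $\mathcal D_n$ with exactly $m$ summands.
   Context: **Shift spaces.** $\mathcal A$ is a countable alphabet, $\mathcal A^*=\bigcup_{k\ge0}\mathcal A^k$. A vertex shift is a set of the form $X=\{x\in\mathcal A^{\mathbb Z}: x_kx_{k+1}\notin\mathcal F\ \forall k\in\mathbb Z\}$ for a finite set $\mathcal F\subseteq\mathcal A^2$ of forbidden 2-blocks. Its language is $\mathcal L(X)=\bigcup_{n\ge0}\mathcal L_n(X)$, where $\mathcal L_n(X)=\{x_1\cdots x_n: x\in X\}$. For $\mathfrak s\in\mathcal A$ and $n\geq 1$, $\mathcal L_n(X,\mathfrak s)=\{w\in\mathcal L_n(X): w_1=\mathfrak s\}$ and $\mathcal L(X,\mathfrak s)=\bigcup_{n\ge1}\mathcal L_n(X,\mathfrak s)$. $X$ is irreducible if for all $u,w\in\mathcal L(X)$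 there is $v\in\mathcal L(X)$ with $uvw\in\mathcal L(X)$. **Compositions.** A composition of $n$ is a finite sequence of positive integers with sum $n$ (the empty sequence is the only composition of $0$). Its length is its number of summands; compositions represent musical scales and the length is the number of notes. **Distinguished symbol rule.** For $w=w_1\cdots w_n\in\mathcal L_n(X)$, $n\ge1$, put $\mathfrak s=w_1$ and let $1=n_1<n_2<\dots<n_r\le n$ be exactly the positions $j$ with $w_j=\mathfrak s$. Then $\varphi(w)=(n_2-n_1,\,n_3-n_2,\,\dots,\,n_r-n_{r-1},\,n-n_r+1)$, a composition of $n$ of length $r$. **Orbits, transversals, dimensions.** The cyclic shift $\alpha$ acts on finite sequences by $\alpha(w_1,\dots,w_k)=(w_2,\dots,w_k,w_1)$; $\mathcal O_\alpha(w)=\{\alpha^j(w):j\in\mathbb Z\}$ and $\mathcal O_\alpha(B)=\bigcup_{w\in B}\mathcal O_\alpha(w)$. A set is independent if distinct elements have disjoint $\alpha$-orbits. A transversal of $B$ is a maximal independent subset of $B$; all transversals of $B$ have the same cardinality, $\dim_{\mathsf T}(B)$ (equivalently, the number of $\alpha$-orbits meeting $B$; it is $0$ if $B=\varnothing$). The orbital dimension is $\dim_{\mathsf O}(B)=\#\mathcal O_\alpha(B)$. A nonempty finite sequence $w$ of length $\ell$ is aperiodic if $\#\mathcal O_\alpha(w)=\ell$. A wheel of size $n$ is an $\alpha$-orbit of compositions of $n$. **Generating functions.** With $B_n=\varphi(\mathcal L_n(X,\mathfrak s))$ for $n\ge1$, $$\dim_{\mathsf T}^{\varphi(X,\mathfrak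 s)}(z)=\sum_{n\ge1}\dim_{\mathsf T}(B_n)z^n,\qquad \dim_{\mathsf O}^{\varphi(X,\mathfrak s)}(z)=1+\sum_{n\ge1}\dim_{\mathsf O}(B_n)z^n,$$ where the constant term $1$ in the orbital series accounts for the empty composition. $C^{\mathcal K}(z)=\sum_{n\ge0}C^{\mathcal K}_nz^n$, where $C_n^{\mathcal K}$ is the number of compositions of $n$ with all summands in $\mathcal K$ (so $C_0^{\mathcal K}=1$); it equals $1/(1-\sum_{k\in\mathcal K}z^k)$. $W^{\mathcal K}(z)=\sum_{n\ge1}W_n^{\mathcal K}z^n$, where $W_n^{\mathcal K}$ is the number of wheels of size $n$ with all summands in $\mathcal K$; it equals $\sum_{k\ge1}\frac{\phi(k)}{k}\log\frac{1}{1-\sum_{j\in\mathcal K}z^{jk}}$, with $\phi$ the Euler totient function. *)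

theory Defs
  imports "HOL-Computational_Algebra.Polynomial" "HOL-Computational_Algebra.Formal_Power_Series"
    "HOL-Library.Countable"
begin

definition vertex_shift :: "(int \<Rightarrow> 'a) set \<Rightarrow> bool" where
  "vertex_shift X \<longleftrightarrow>
     (\<exists>F :: ('a \<times> 'a) set. finite F \<and> X = {x. \<forall>k. (x k, x (k + 1)) \<notin> F})"

definition lang_n :: "(int \<Rightarrow> 'a) set \<Rightarrow> nat \<Rightarrow> 'a list set" where
  "lang_n X n = {map x [1..int n] | x. x \<in> X}"

definition lang :: "(int \<Rightarrow> 'a) set \<Rightarrow> 'a list set" where
  "lang X = (\<Union>n. lang_n X n)"

definition lang_from :: "(int \<Rightarrow> 'a) set \<Rightarrow> 'a \<Rightarrow> nat \<Rightarrow> 'a list set" where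
  "lang_from X s n = {w \<in> lang_n X n. w \<noteq> [] \<and> hd w = s}"

definition irreducible_shift :: "(int \<Rightarrow> 'a) set \<Rightarrow> bool" where
  "irreducible_shift X \<longleftrightarrow>
     (\<forall>u \<in> lang X. \<forall>w \<in> lang X. \<exists>v \<in> lang X. u @ v @ w \<in> lang X)"

definition compositions :: "nat \<Rightarrow> nat list set" where
  "compositions n = {c. (\<forall>k \<in> set c. 0 < k) \<and> sum_list c = n}"

text \<open>Positions are counted from 1, hence the shift in the list index.\<close>

definition symbol_positions :: "'a list \<Rightarrow> nat list" where
  "symbol_positions w = filter (\<lambda>j. w ! (j - 1) = hd w) [1..<length w + 1]"

definition distinguished_symbol_rule :: "'a list \<Rightarrow> nat list" where
  "distinguished_symbol_rule w =
     (let p = symbol_positions w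
      in map (\<lambda>i. p ! (i + 1) - p ! i) [0..<length p - 1] @ [length w - last p + 1])"

text \<open>The second disjunct accounts for the negative powers of the cyclic shift
  \<^const>\<open>rotate1\<close>.\<close>

definition cyclic_orbit :: "'b list \<Rightarrow> 'b list set" where
  "cyclic_orbit w = {v. \<exists>j. v = (rotate1 ^^ j) w \<or> w = (rotate1 ^^ j) v}"

definition independent_words :: "'b list set \<Rightarrow> bool" where
  "independent_words S \<longleftrightarrow>
     (\<forall>v \<in> S. \<forall>w \<in> S. v \<noteq> w \<longrightarrow> cyclic_orbit v \<inter> cyclic_orbit w = {})"

definition transversal :: "'b list set \<Rightarrow> 'b list set \<Rightarrow> bool" where
  "transversal B T \<longleftrightarrow>
     T \<subseteq> B \<and> independent_words T \<and>
     (\<forall>S. T \<subseteq> S \<and> S \<subseteq> B \<and> independent_words S \<longrightarrow> S = T)"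

text \<open>Both dimensions are only used for sets of compositions of a fixed number; these sets are
  finite, so \<^const>\<open>card\<close> does not degenerate.\<close>

definition dim_T :: "'b list set \<Rightarrow> nat" where
  "dim_T B = (THE d. \<exists>T. transversal B T \<and> card T = d)"

definition dim_O :: "'b list set \<Rightarrow> nat" where
  "dim_O B = card (\<Union>w \<in> B. cyclic_orbit w)"

definition aperiodic :: "'b list \<Rightarrow> bool" where
  "aperiodic w \<longleftrightarrow> w \<noteq> [] \<and> card (cyclic_orbit w) = length w"

definition wheels :: "nat \<Rightarrow> nat list set set" where
  "wheels n = cyclic_orbit ` compositions n"

definition transversal_gf :: "(int \<Rightarrow> 'a) set \<Rightarrow> 'a \<Rightarrow> int fps" where
  "transversal_gf X s = Abs_fps (\<lambda>n. if n = 0 then 0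
     else int (dim_T (distinguished_symbol_rule ` lang_from X s n)))"

definition orbital_gf :: "(int \<Rightarrow> 'a) set \<Rightarrow> 'a \<Rightarrow> int fps" where
  "orbital_gf X s = Abs_fps (\<lambda>n. if n = 0 then 1
     else int (dim_O (distinguished_symbol_rule ` lang_from X s n)))"

definition num_compositions :: "nat set \<Rightarrow> nat \<Rightarrow> nat" where
  "num_compositions K n = card {c \<in> compositions n. set c \<subseteq> K}"

definition num_wheels :: "nat set \<Rightarrow> nat \<Rightarrow> nat" where
  "num_wheels K n = card {W \<in> wheels n. \<forall>c \<in> W. set c \<subseteq> K}"

definition composition_gf :: "nat set \<Rightarrow> int fps" where
  "composition_gf K = Abs_fps (\<lambda>n. int (num_compositions K n))"

definition wheel_gf :: "nat set \<Rightarrow> int fps" where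
  "wheel_gf K = Abs_fps (\<lambda>n. if n = 0 then 0 else int (num_wheels K n))"

definition return_lengths :: "(int \<Rightarrow> 'a) set \<Rightarrow> 'a \<Rightarrow> nat set" where
  "return_lengths X s =
     {k. 1 \<le> k \<and> (\<exists>w \<in> lang_n X (k + 1).
        w ! 0 = s \<and> w ! k = s \<and> (\<forall>j. 0 < j \<and> j < k \<longrightarrow> w ! j \<noteq> s))}"

definition pos_compl :: "nat set \<Rightarrow> nat set" where
  "pos_compl K = {0<..} - K"

text \<open>The class of compositions whose summands lie in \<open>K\<close>, except that the last one is
  missing from \<open>K\<close> and is smaller than some element of \<open>K\<close>.\<close>

definition defect_class :: "nat set \<Rightarrow> nat list set" where
  "defect_class K = {c. c \<noteq> [] \<and> (\<forall>k \<in> set c. 0 < k) \<and> set (butlast c) \<subseteq> K \<and>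
     last c \<in> pos_compl K \<and> (\<exists>k' \<in> K. last c < k')}"

definition defect_n :: "nat set \<Rightarrow> nat \<Rightarrow> nat list set" where
  "defect_n K n = defect_class K \<inter> compositions n"

definition defect_gf :: "nat set \<Rightarrow> int fps" where
  "defect_gf K = Abs_fps (\<lambda>n. if n = 0 then 0 else int (card (defect_n K n)))"

definition defect_orbital_gf :: "nat set \<Rightarrow> int fps" where
  "defect_orbital_gf K = Abs_fps (\<lambda>n. if n = 0 then 0 else int (dim_O (defect_n K n)))"

definition num_defect :: "nat set \<Rightarrow> nat \<Rightarrow> nat \<Rightarrow> nat" where
  "num_defect K n m = card {c \<in> defect_n K n. length c = m}"

text \<open>A composition of \<open>n\<close> has at most \<open>n\<close> summands, so the bivariate generating function is a
  power series in \<open>z\<close> whose coefficients are polynomials in \<open>u\<close>.\<close>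

definition defect_gf2 :: "nat set \<Rightarrow> int poly fps" where
  "defect_gf2 K = Abs_fps (\<lambda>n. if n = 0 then 0
     else (\<Sum>m = 1..n. monom (int (num_defect K n m)) m))"

lemma length_le_sum_list:
  fixes c :: "nat list"
  assumes "\<forall>k \<in> set c. 0 < k"
  shows "length c \<le> sum_list c"
  using assms by (induction c) auto

lemma coeff_defect_gf2:
  assumes "1 \<le> n" "1 \<le> m"
  shows "poly.coeff (fps_nth (defect_gf2 K) n) m = int (num_defect K n m)"
proof (cases "m \<le> n")
  case True
  then show ?thesis
    using assms by (simp add: defect_gf2_def coeff_sum)
next
  case False
  have "length c \<le> n" if "c \<in> defect_n K n" for c
    using that length_le_sum_list[of c] by (auto simp: defect_n_def compositions_def)
  with False have "{c \<in> defect_n K n. length c = m} = {}"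
    by auto
  then have "num_defect K n m = 0"
    unfolding num_defect_def by (metis card.empty)
  with False assms show ?thesis
    by (simp add: defect_gf2_def coeff_sum)
qed

definition deriv_u_at_1 :: "int poly fps \<Rightarrow> int fps" where
  "deriv_u_at_1 A = Abs_fps (\<lambda>n. poly (pderiv (fps_nth A n)) 1)"

end

theory Submission
  imports Defs
begin

text \<open>Cutting a word starting with \<open>s\<close> at its occurrences of \<open>s\<close> yields return blocks, whose
  lengths are in \<open>K\<close>, and a last block which by irreducibility is an initial part of a return
  block. Conversely, blocks can be concatenated freely. Hence the image of the rule consists of
  the compositions whose summands are in \<open>K\<close>, except that the last one need only be bounded by
  an element of \<open>K\<close>: the compositions over \<open>K\<close> and the defect class. A defect composition has
  exactly one summand outside \<open>K\<close>, at its end. It is therefore aperiodic, it is the only defect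
  composition in its orbit, and its orbit contains no composition over \<open>K\<close>; so both dimensions
  are additive over the two classes.\<close>

section \<open>Cyclic orbits\<close>

text \<open>Rotation by the length is the identity, so each negative power of the shift is also a
  nonnegative one.\<close>

lemma cyclic_orbit_eq_rotate: "cyclic_orbit w = range (\<lambda>j. rotate j w)"
proof -
  have "\<exists>i. v = rotate i w" if "w = rotate j v" for v j
  proof -
    have "rotate (length v - j mod length v) w = rotate (length v - j mod length v + j mod length v) v"
      by (simp only: that rotate_rotate mod_add_right_eq rotate_conv_mod[of "_ + _"]
          rotate_conv_mod[of "_ + _ mod _"])
    also have "\<dots> = v"
      by (cases "v = []") (simp_all add: less_imp_le)
    finally show ?thesis by metis
  qed
  then show ?thesis
    unfolding cyclic_orbit_def rotate_def[symmetric] by blast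
qed

lemma self_in_cyclic_orbit: "w \<in> cyclic_orbit w"
  by (auto simp: cyclic_orbit_eq_rotate intro!: range_eqI[of _ _ 0])

lemma cyclic_orbit_eqI:
  assumes "v \<in> cyclic_orbit w"
  shows "cyclic_orbit v = cyclic_orbit w"
proof -
  have sub: "cyclic_orbit a \<subseteq> cyclic_orbit b" if "a \<in> cyclic_orbit b" for a b :: "'a list"
    using that by (auto simp: cyclic_orbit_eq_rotate rotate_rotate)
  moreover have "w \<in> cyclic_orbit v"
    using assms by (auto simp: cyclic_orbit_def)
  ultimately show ?thesis
    using assms by blast
qed

text \<open>Orbits are equivalence classes. This turns independence into injectivity of
  \<open>cyclic_orbit\<close>.\<close>

lemma cyclic_orbits_disjoint_iff:
  "cyclic_orbit v \<inter> cyclic_orbit w = {} \<longleftrightarrow> cyclic_orbit v \<noteq> cyclic_orbit w"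
proof
  assume "cyclic_orbit v \<inter> cyclic_orbit w = {}"
  then show "cyclic_orbit v \<noteq> cyclic_orbit w"
    using self_in_cyclic_orbit by fastforce
next
  assume "cyclic_orbit v \<noteq> cyclic_orbit w"
  then show "cyclic_orbit v \<inter> cyclic_orbit w = {}"
    by (metis cyclic_orbit_eqI disjoint_iff)
qed

lemma cyclic_orbit_eq_lessThan:
  assumes "w \<noteq> []"
  shows "cyclic_orbit w = (\<lambda>j. rotate j w) ` {..<length w}"
proof -
  have "rotate j w \<in> (\<lambda>j. rotate j w) ` {..<length w}" for j
  proof (rule image_eqI)
    show "rotate j w = rotate (j mod length w) w"
      by (rule rotate_conv_mod)
  qed (use assms in simp)
  then show ?thesis
    by (auto simp: cyclic_orbit_eq_rotate)
qed

lemma set_of_cyclic_orbit: "v \<in> cyclic_orbit w \<Longrightarrow> set v = set w"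
  by (auto simp: cyclic_orbit_eq_rotate)

lemma finite_cyclic_orbit: "finite (cyclic_orbit w)"
proof (cases "w = []")
  case True
  then show ?thesis by (simp add: cyclic_orbit_eq_rotate)
next
  case False
  then show ?thesis by (simp add: cyclic_orbit_eq_lessThan)
qed

lemma cyclic_orbit_subset_compositions:
  assumes "c \<in> compositions n"
  shows "cyclic_orbit c \<subseteq> compositions n"
proof
  fix d assume "d \<in> cyclic_orbit c"
  then obtain j where d: "d = rotate j c"
    by (auto simp: cyclic_orbit_eq_rotate)
  have "sum_list d = sum_list c"
    using sum_list_append[of "drop (j mod length c) c" "take (j mod length c) c"]
      sum_list_append[of "take (j mod length c) c" "drop (j mod length c) c"]
    by (simp add: d rotate_drop_take)
  then show "d \<in> compositions n"
    using assms by (simp add: compositions_def d)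
qed

section \<open>Transversals and the number of orbits\<close>

lemma independent_words_iff_inj_on: "independent_words S \<longleftrightarrow> inj_on cyclic_orbit S"
  unfolding independent_words_def inj_on_def cyclic_orbits_disjoint_iff by blast

text \<open>By maximality no orbit is missed, since a word of a missed orbit could be added.
  Conversely, any further word of \<open>B\<close> would share its orbit with a word of
  \<open>T\<close>.\<close>

lemma transversal_iff:
  "transversal B T \<longleftrightarrow> T \<subseteq> B \<and> inj_on cyclic_orbit T \<and> cyclic_orbit ` T = cyclic_orbit ` B"
proof
  assume T: "transversal B T"
  then have sub: "T \<subseteq> B" and inj: "inj_on cyclic_orbit T"
    by (auto simp: transversal_def independent_words_iff_inj_on)
  have "cyclic_orbit b \<in> cyclic_orbit ` T" if "b \<in> B" for b
  proof (rule ccontr)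
    assume nin: "cyclic_orbit b \<notin> cyclic_orbit ` T"
    with inj have "inj_on cyclic_orbit (insert b T)"
      by auto
    then have "insert b T = T"
      using T sub that unfolding transversal_def independent_words_iff_inj_on by blast
    with nin show False by blast
  qed
  with sub inj show "T \<subseteq> B \<and> inj_on cyclic_orbit T \<and> cyclic_orbit ` T = cyclic_orbit ` B"
    by blast
next
  assume T: "T \<subseteq> B \<and> inj_on cyclic_orbit T \<and> cyclic_orbit ` T = cyclic_orbit ` B"
  have "S = T" if S: "T \<subseteq> S" "S \<subseteq> B" "inj_on cyclic_orbit S" for S
  proof -
    have "x \<in> T" if "x \<in> S" for x
    proof -
      have "cyclic_orbit x \<in> cyclic_orbit ` B"
        using S that by blast
      then have "cyclic_orbit x \<in> cyclic_orbit ` T"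
        using T by simp
      with S that show ?thesis
        unfolding inj_on_def by blast
    qed
    with S show ?thesis by blast
  qed
  with T show "transversal B T"
    by (auto simp: transversal_def independent_words_iff_inj_on)
qed

text \<open>Each transversal is in bijection with the orbits meeting \<open>B\<close>, and one
  exists by choosing a word of \<open>B\<close> from each orbit. Hence exactly one number satisfies
  the description under \<open>THE\<close>.\<close>

lemma dim_T_eq_card_orbits: "dim_T B = card (cyclic_orbit ` B)"
  unfolding dim_T_def
proof (rule the_equality)
  obtain T where "T \<subseteq> B" "inj_on cyclic_orbit T" "cyclic_orbit ` B = cyclic_orbit ` T"
    using subset_image_inj[of "cyclic_orbit ` B" cyclic_orbit B] by auto
  then show "\<exists>T. transversal B T \<and> card T = card (cyclic_orbit ` B)"
    by (metis transversal_iff card_image)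
next
  fix d assume "\<exists>T. transversal B T \<and> card T = d"
  then show "d = card (cyclic_orbit ` B)"
    by (metis transversal_iff card_image)
qed

text \<open>The only occurrence of \<open>l\<close> sits at a different position in each rotation by
  less than the length, so these rotations are pairwise distinct.\<close>

lemma aperiodic_snoc:
  assumes "l \<notin> set b"
  shows "aperiodic (b @ [l])"
proof -
  define c where "c = b @ [l]"
  \<comment> \<open>The number of entries before \<open>l\<close> recovers the rotation amount
    \<open>i\<close>.\<close>
  have pos: "length (takeWhile (\<lambda>x. x \<noteq> l) (rotate i c)) = length b - i" if "i < length c" for i
  proof -
    have "rotate i c = drop i b @ l # take i c"
      using that by (simp add: rotate_drop_take c_def)
    moreover have "\<forall>x\<in>set (drop i b). x \<noteq> l"
      using assms by (metis in_set_dropD)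
    ultimately show ?thesis
      by (simp add: takeWhile_append2)
  qed
  have "inj_on (\<lambda>j. rotate j c) {..<length c}"
  proof (rule inj_onI)
    fix i j assume "i \<in> {..<length c}" "j \<in> {..<length c}" "rotate i c = rotate j c"
    then show "i = j"
      using pos[of i] pos[of j] by (auto simp: c_def)
  qed
  then have "card (cyclic_orbit c) = length c"
    by (simp add: cyclic_orbit_eq_lessThan c_def card_image)
  then show ?thesis
    by (simp add: aperiodic_def c_def)
qed

section \<open>The defect class\<close>

lemma finite_compositions: "finite (compositions n)"
proof (rule finite_subset)
  show "compositions n \<subseteq> {c. set c \<subseteq> {..n} \<and> length c \<le> n}"
    using length_le_sum_list by (auto simp: compositions_def dest: member_le_sum_list)
  show "finite {c. set c \<subseteq> {..n} \<and> length c \<le> n}"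
    by (rule finite_lists_length_le) simp
qed

lemma finite_defect_n: "finite (defect_n K n)"
  by (simp add: defect_n_def finite_compositions)

lemma defect_class_snoc:
  assumes "c \<in> defect_class K"
  obtains b l where "c = b @ [l]" "set b \<subseteq> K" "l \<notin> K"
proof
  show "c = butlast c @ [last c]" "set (butlast c) \<subseteq> K" "last c \<notin> K"
    using assms by (auto simp: defect_class_def pos_compl_def)
qed

lemma aperiodic_defect_class: "c \<in> defect_class K \<Longrightarrow> aperiodic c"
  by (metis aperiodic_snoc defect_class_snoc subsetD)

text \<open>A nontrivial rotation moves the last summand, which is outside \<open>K\<close>, to a
  non-final position, where a defect composition only has summands in \<open>K\<close>.\<close>

lemma inj_on_cyclic_orbit_defect_class: "inj_on cyclic_orbit (defect_class K)"
proof (rule inj_onI)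
  fix c d assume c: "c \<in> defect_class K" and d: "d \<in> defect_class K"
    and eq: "cyclic_orbit c = cyclic_orbit d"
  obtain b l where b: "c = b @ [l]" "l \<notin> K"
    using c by (rule defect_class_snoc)
  obtain b' l' where b': "d = b' @ [l']" "set b' \<subseteq> K"
    using d by (rule defect_class_snoc)
  have "d \<in> (\<lambda>j. rotate j c) ` {..<length c}"
    using eq self_in_cyclic_orbit[of d] cyclic_orbit_eq_lessThan[of c] b by auto
  then obtain i where i: "i < length c" "d = drop i c @ take i c"
    by (auto simp: rotate_drop_take)
  have "i = 0"
  proof (rule ccontr)
    assume "i \<noteq> 0"
    with i b have "take i c \<noteq> []" by auto
    with i have "butlast d = drop i c @ butlast (take i c)"
      by (simp add: butlast_append)
    moreover have "l \<in> set (drop i c)"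
      using i b by simp
    ultimately show False
      using b b' by auto
  qed
  with i show "c = d" by simp
qed

text \<open>Removing the last summand \<open>k\<close> leaves an arbitrary composition of
  \<open>n - k\<close> over \<open>K\<close>; the bound \<open>k \<le> n\<close> keeps the
  subtraction from truncating.\<close>

lemma card_defect_n:
  "card (defect_n K n) =
    (\<Sum>k | k \<in> pos_compl K \<and> k \<le> n \<and> (\<exists>k' \<in> K. k < k'). num_compositions K (n - k))"
proof -
  define I where "I = {k. k \<in> pos_compl K \<and> k \<le> n \<and> (\<exists>k' \<in> K. k < k')}"
  define A where "A k = {c \<in> compositions (n - k). set c \<subseteq> K}" for k
  have "finite I"
    unfolding I_def by (rule finite_subset[of _ "{..n}"]) auto
  have "finite (A k)" for k
    by (simp add: A_def finite_compositions)
  have "bij_betw (\<lambda>(k, c). c @ [k]) (Sigma I A) (defect_n K n)"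
  proof (rule bij_betw_byWitness[where f' = "\<lambda>c. (last c, butlast c)"])
    show "\<forall>a \<in> Sigma I A. (\<lambda>c. (last c, butlast c)) ((\<lambda>(k, c). c @ [k]) a) = a"
      by auto
    show "\<forall>a' \<in> defect_n K n. (\<lambda>(k, c). c @ [k]) (last a', butlast a') = a'"
      by (auto simp: defect_n_def defect_class_def)
    show "(\<lambda>(k, c). c @ [k]) ` Sigma I A \<subseteq> defect_n K n"
      by (auto simp: I_def A_def defect_n_def defect_class_def compositions_def pos_compl_def)
    show "(\<lambda>c. (last c, butlast c)) ` defect_n K n \<subseteq> Sigma I A"
    proof (rule image_subsetI)
      fix c assume c: "c \<in> defect_n K n"
      then have cs: "c = butlast c @ [last c]"
        by (simp add: defect_n_def defect_class_def)
      have "sum_list c = n"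
        using c by (simp add: defect_n_def compositions_def)
      then have "sum_list (butlast c) + last c = n"
        using arg_cong[OF cs, of sum_list] by simp
      moreover have "\<forall>k \<in> set (butlast c). 0 < k"
        using c by (auto simp: defect_n_def compositions_def dest: in_set_butlastD)
      ultimately show "(last c, butlast c) \<in> Sigma I A"
        using c by (auto simp: I_def A_def defect_n_def defect_class_def compositions_def)
    qed
  qed
  then have "card (defect_n K n) = card (Sigma I A)"
    by (metis bij_betw_same_card)
  also have "\<dots> = (\<Sum>k\<in>I. card (A k))"
    using \<open>finite I\<close> \<open>\<And>k. finite (A k)\<close> by simp
  finally show ?thesis
    by (simp add: I_def A_def num_compositions_def)
qed

text \<open>Distinct defect compositions have disjoint orbits, and aperiodicity makes each orbit as
  large as the number of summands.\<close>

lemma dim_O_defect_n: "dim_O (defect_n K n) = (\<Sum>c\<in>defect_n K n. length c)"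
proof -
  have "dim_O (defect_n K n) = (\<Sum>c\<in>defect_n K n. card (cyclic_orbit c))"
    unfolding dim_O_def
  proof (rule card_UN_disjoint)
    show "\<forall>c\<in>defect_n K n. \<forall>d\<in>defect_n K n. c \<noteq> d \<longrightarrow> cyclic_orbit c \<inter> cyclic_orbit d = {}"
      using inj_on_cyclic_orbit_defect_class[of K]
      by (auto simp: cyclic_orbits_disjoint_iff inj_on_def defect_n_def)
  qed (simp_all add: finite_defect_n finite_cyclic_orbit)
  also have "\<dots> = (\<Sum>c\<in>defect_n K n. length c)"
    using aperiodic_defect_class by (intro sum.cong) (auto simp: aperiodic_def defect_n_def)
  finally show ?thesis .
qed

lemma sum_length_defect_n:
  "(\<Sum>c\<in>defect_n K n. length c) = (\<Sum>m = 1..n. m * num_defect K n m)"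
proof -
  have "length ` defect_n K n \<subseteq> {1..n}"
  proof (rule image_subsetI)
    fix c assume "c \<in> defect_n K n"
    then show "length c \<in> {1..n}"
      using length_le_sum_list[of c]
      by (auto simp: defect_n_def defect_class_def compositions_def Suc_le_eq)
  qed
  then have "(\<Sum>c\<in>defect_n K n. length c)
      = (\<Sum>m = 1..n. \<Sum>c | c \<in> defect_n K n \<and> length c = m. length c)"
    by (intro sum.group[symmetric]) (simp_all add: finite_defect_n)
  also have "\<dots> = (\<Sum>m = 1..n. m * num_defect K n m)"
    by (intro sum.cong) (simp_all add: num_defect_def mult.commute)
  finally show ?thesis .
qed

text \<open>At \<open>u = 1\<close> the derivative of \<open>u^m\<close> is \<open>m\<close>, so
  differentiation weights each defect composition by its number of summands, which is the size of
  its orbit.\<close>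

lemma defect_orbital_gf_eq_deriv: "defect_orbital_gf K = deriv_u_at_1 (defect_gf2 K)"
proof (rule fps_ext)
  fix n
  have "poly (pderiv (\<Sum>m = 1..n. monom (int (num_defect K n m)) m)) 1
      = (\<Sum>m = 1..n. int (m * num_defect K n m))"
    \<comment> \<open>The case of order 1 of \<open>higher_pderiv_sum\<close> is the additivity of
      \<open>pderiv\<close>.\<close>
    by (simp add: higher_pderiv_sum[of 1, simplified] poly_sum pderiv_monom poly_monom)
  then show "fps_nth (defect_orbital_gf K) n = fps_nth (deriv_u_at_1 (defect_gf2 K)) n"
    by (simp add: defect_orbital_gf_def deriv_u_at_1_def defect_gf2_def dim_O_defect_n
        sum_length_defect_n)
qed

section \<open>The language of a vertex shift\<close>

lemma length_lang_n: "w \<in> lang_n X n \<Longrightarrow> length w = n"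
  by (auto simp: lang_n_def)

lemma lang_n_eq: "lang_n X n = {w \<in> lang X. length w = n}"
  by (auto simp: lang_def length_lang_n)

lemma vertex_shift_translate:
  assumes "vertex_shift X" "x \<in> X"
  shows "(\<lambda>i. x (i + t)) \<in> X"
proof -
  obtain F where X: "X = {x. \<forall>k. (x k, x (k + 1)) \<notin> F}"
    using assms(1) by (auto simp: vertex_shift_def)
  have "(x (k + t), x (k + 1 + t)) \<notin> F" for k
  proof -
    have "(x (k + t), x (k + t + 1)) \<notin> F"
      using assms(2) by (simp add: X)
    then show ?thesis
      by (simp add: algebra_simps)
  qed
  then show ?thesis by (simp add: X)
qed

text \<open>Translation invariance lets a word be read off a point in any window, not only at the
  positions from 1 on. Factors and splicing are handled in this form.\<close>

lemma lang_iff_occurs: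
  assumes "vertex_shift X"
  shows "w \<in> lang X \<longleftrightarrow> (\<exists>x\<in>X. \<exists>t. \<forall>i<length w. w ! i = x (t + int i))"
proof
  assume "w \<in> lang X"
  then obtain x n where "x \<in> X" "w = map x [1..int n]"
    by (auto simp: lang_def lang_n_def)
  then show "\<exists>x\<in>X. \<exists>t. \<forall>i<length w. w ! i = x (t + int i)"
    by (auto intro!: bexI[of _ x] exI[of _ 1])
next
  assume "\<exists>x\<in>X. \<exists>t. \<forall>i<length w. w ! i = x (t + int i)"
  then obtain x t where x: "x \<in> X" "\<forall>i<length w. w ! i = x (t + int i)"
    by blast
  \<comment> \<open>Translating by \<open>t - 1\<close> moves the window that starts at
    \<open>t\<close> to position 1.\<close>
  have "w = map (\<lambda>i. x (i + (t - 1))) [1..int (length w)]"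
    using x by (intro nth_equalityI) (auto simp: algebra_simps)
  then show "w \<in> lang X"
    using vertex_shift_translate[OF assms x(1), of "t - 1"]
    unfolding lang_def lang_n_def by blast
qed

lemma lang_factor:
  assumes "vertex_shift X" "u @ v @ w \<in> lang X"
  shows "v \<in> lang X"
proof -
  obtain x t where x: "x \<in> X" "\<forall>i<length (u @ v @ w). (u @ v @ w) ! i = x (t + int i)"
    using assms lang_iff_occurs by blast
  have "v ! i = x (t + int (length u) + int i)" if "i < length v" for i
    using x(2)[rule_format, of "length u + i"] that by (simp add: nth_append algebra_simps)
  with x(1) show ?thesis
    using lang_iff_occurs[OF assms(1)] by blast
qed

lemma lang_prefix: "vertex_shift X \<Longrightarrow> v @ w \<in> lang X \<Longrightarrow> v \<in> lang X"
  using lang_factor[of X "[]"] by simp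

lemma lang_suffix: "vertex_shift X \<Longrightarrow> u @ v \<in> lang X \<Longrightarrow> v \<in> lang X"
  using lang_factor[of X u v "[]"] by simp

text \<open>Only blocks of length two are forbidden, so two points may be spliced at a common symbol.\<close>

lemma lang_splice:
  assumes "vertex_shift X" "u @ [a] \<in> lang X" "a # w \<in> lang X"
  shows "u @ a # w \<in> lang X"
proof -
  obtain F where X: "X = {x. \<forall>k. (x k, x (k + 1)) \<notin> F}"
    using assms(1) by (auto simp: vertex_shift_def)
  obtain x t where x: "x \<in> X" "\<forall>i<length (u @ [a]). (u @ [a]) ! i = x (t + int i)"
    using assms lang_iff_occurs by blast
  obtain y r where y: "y \<in> X" "\<forall>i<length (a # w). (a # w) ! i = y (r + int i)"
    using assms lang_iff_occurs by blast
  define p where "p = int (length u)"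
  define z where "z i = (if i \<le> p then x (t + i) else y (r + (i - p)))" for i
  have xa: "x (t + p) = a"
    using x(2)[rule_format, of "length u"] by (simp add: p_def)
  have ya: "y r = a"
    using y(2)[rule_format, of 0] by simp
  have "(z k, z (k + 1)) \<notin> F" for k
  proof -
    have "(x (t + k), x (t + k + 1)) \<notin> F" "(y (r + (k - p)), y (r + (k - p) + 1)) \<notin> F"
      using x(1) y(1) by (simp_all add: X)
    \<comment> \<open>At \<open>k = p\<close> the 2-block straddles the junction; as both points
      show \<open>a\<close> there, it is a block of \<open>y\<close>. Every other 2-block lies
      within one of the two points.\<close>
    then show ?thesis
      using xa ya by (cases k p rule: linorder_cases) (auto simp: z_def algebra_simps)
  qed
  then have "z \<in> X" by (simp add: X)
  moreover have "(u @ a # w) ! i = z (0 + int i)" if "i < length (u @ a # w)" for i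
  proof (cases "i \<le> length u")
    case True
    then have "(u @ a # w) ! i = (u @ [a]) ! i"
      by (auto simp: nth_append)
    with True x(2) show ?thesis
      by (simp add: z_def p_def)
  next
    case False
    with that y(2)[rule_format, of "i - length u"] show ?thesis
      by (simp add: z_def p_def nth_append of_nat_diff)
  qed
  ultimately show ?thesis
    using lang_iff_occurs[OF assms(1)] by blast
qed

text \<open>Replaces indices by a factorization. The block counted is \<open>s # v\<close>; the
  closing \<open>s\<close> already belongs to the next block, whence the length
  \<open>Suc (length v)\<close>.\<close>

lemma return_lengths_iff:
  "k \<in> return_lengths X s \<longleftrightarrow> (\<exists>v. s \<notin> set v \<and> k = Suc (length v) \<and> s # v @ [s] \<in> lang X)"
proof
  assume "k \<in> return_lengths X s"
  then obtain w where w: "1 \<le> k" "w \<in> lang X" "length w = Suc k" "w ! 0 = s" "w ! k = s"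
    "\<forall>j. 0 < j \<and> j < k \<longrightarrow> w ! j \<noteq> s"
    by (auto simp: return_lengths_def lang_n_eq)
  define v where "v = butlast (tl w)"
  have wv: "w = s # v @ [s]"
  proof -
    obtain w' where w': "w = s # w'"
      using w(3,4) by (cases w) auto
    then have "w' \<noteq> []"
      using w(1,3) by auto
    moreover have "last w' = s"
      using w(1,3,5) w' \<open>w' \<noteq> []\<close> by (simp add: last_conv_nth nth_Cons')
    ultimately show ?thesis
      by (metis v_def w' list.sel(3) append_butlast_last_id)
  qed
  have "v ! i \<noteq> s" if "i < length v" for i
    using w(6)[rule_format, of "Suc i"] w(3) that by (simp add: wv nth_append)
  then show "\<exists>v. s \<notin> set v \<and> k = Suc (length v) \<and> s # v @ [s] \<in> lang X"
    using w(2,3) wv by (intro exI[of _ v]) (auto simp: in_set_conv_nth)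
next
  assume "\<exists>v. s \<notin> set v \<and> k = Suc (length v) \<and> s # v @ [s] \<in> lang X"
  then obtain v where v: "s \<notin> set v" "k = Suc (length v)" "s # v @ [s] \<in> lang X"
    by blast
  have "(s # v @ [s]) ! j \<noteq> s" if "0 < j" "j < k" for j
    using that v(1,2) by (cases j) (auto simp: nth_append)
  then show "k \<in> return_lengths X s"
    using v by (auto simp: return_lengths_def lang_n_eq intro!: bexI[of _ "s # v @ [s]"])
qed

section \<open>The image of the distinguished symbol rule\<close>

lemma symbol_positions_no_return:
  assumes "s \<notin> set v"
  shows "symbol_positions (s # v) = [1]"
proof -
  have "[1..<length (s # v) + 1] = 1 # [2..<length v + 2]"
    by (simp add: upt_conv_Cons numeral_2_eq_2 del: upt_Suc)
  moreover have "filter (\<lambda>j. (s # v) ! (j - 1) = s) [2..<length v + 2] = []"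
  proof -
    have "(s # v) ! (j - 1) \<in> set v" if "j \<in> set [2..<length v + 2]" for j
      using that by (auto simp: nth_Cons' intro!: nth_mem)
    with assms show ?thesis
      by (metis (mono_tags, lifting) filter_False)
  qed
  ultimately show ?thesis
    by (simp add: symbol_positions_def)
qed

text \<open>The range of positions is split after the first block: that block contributes only 1,
  and the rest is a translate of the range for \<open>s # r\<close>.\<close>

lemma symbol_positions_return:
  assumes "s \<notin> set v"
  shows "symbol_positions (s # v @ s # r) =
    1 # map (\<lambda>j. j + Suc (length v)) (symbol_positions (s # r))"
proof -
  let ?w = "s # v @ s # r" and ?k = "Suc (length v)"
  have "[1..<length ?w + 1] = [1..<length (s # v) + 1] @ [1 + ?k..<length (s # r) + 1 + ?k]"
    using upt_add_eq_append[of 1 "length (s # v) + 1" "length (s # r)"]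
    by (simp add: add.commute add.left_commute)
  also have "[1 + ?k..<length (s # r) + 1 + ?k] = map (\<lambda>j. j + ?k) [1..<length (s # r) + 1]"
    by (rule nth_equalityI) (simp_all del: upt_Suc)
  finally have "symbol_positions ?w =
      filter (\<lambda>j. ?w ! (j - 1) = s) [1..<length (s # v) + 1] @
      map (\<lambda>j. j + ?k) (filter (\<lambda>j. ?w ! (j + ?k - 1) = s) [1..<length (s # r) + 1])"
    by (simp only: symbol_positions_def filter_append filter_map o_def list.sel)
  moreover have "filter (\<lambda>j. ?w ! (j - 1) = s) [1..<length (s # v) + 1]
      = filter (\<lambda>j. (s # v) ! (j - 1) = s) [1..<length (s # v) + 1]"
  proof (rule filter_cong)
    fix j assume "j \<in> set [1..<length (s # v) + 1]"
    then have "j - 1 < length (s # v)"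
      by auto
    then have "((s # v) @ s # r) ! (j - 1) = (s # v) ! (j - 1)"
      by (simp only: nth_append if_True)
    then show "(?w ! (j - 1) = s) = ((s # v) ! (j - 1) = s)"
      by simp
  qed simp
  moreover have "filter (\<lambda>j. ?w ! (j + ?k - 1) = s) [1..<length (s # r) + 1]
      = filter (\<lambda>j. (s # r) ! (j - 1) = s) [1..<length (s # r) + 1]"
    by (rule filter_cong) (auto simp: nth_Cons' nth_append)
  moreover have "filter (\<lambda>j. (s # v) ! (j - 1) = s) [1..<length (s # v) + 1] = [1]"
    using symbol_positions_no_return[OF assms] by (simp only: symbol_positions_def list.sel)
  ultimately show ?thesis
    by (simp only: symbol_positions_def[of "s # r"] list.sel append_Cons append_Nil)
qed

lemma symbol_positions_Cons: "\<exists>p. symbol_positions (s # r) = 1 # p"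
proof -
  have "[1..<length (s # r) + 1] = 1 # [2..<length (s # r) + 1]"
    by (simp add: upt_conv_Cons numeral_2_eq_2 del: upt_Suc)
  then show ?thesis by (simp add: symbol_positions_def)
qed

section \<open>The rule as a recursion over blocks\<close>

lemma rule_no_return:
  "s \<notin> set v \<Longrightarrow> distinguished_symbol_rule (s # v) = [Suc (length v)]"
  by (simp add: distinguished_symbol_rule_def symbol_positions_no_return)

text \<open>Differences of positions and the distance to the end do not change when all positions
  and the length grow by \<open>?k\<close>, so prepending a block only prepends its length.\<close>

lemma rule_return:
  assumes "s \<notin> set v"
  shows "distinguished_symbol_rule (s # v @ s # r) =
    Suc (length v) # distinguished_symbol_rule (s # r)"
proof -
  obtain p where p: "symbol_positions (s # r) = 1 # p"
    using symbol_positions_Cons[of s r] by blast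
  let ?k = "Suc (length v)"
  let ?q = "map (\<lambda>j. j + ?k) (1 # p)"
  \<comment> \<open>The new first difference is \<open>(1 + ?k) - 1\<close>, because the shifted
    list starts at \<open>1 + ?k\<close>.\<close>
  have "map (\<lambda>i. (1 # ?q) ! (i + 1) - (1 # ?q) ! i) [0..<Suc (length p)]
      = ?k # map (\<lambda>i. ?q ! (i + 1) - ?q ! i) [0..<length p]"
    by (simp add: upt_conv_Cons map_Suc_upt[symmetric] o_def del: upt_Suc list.map)
       (simp)
  also have "map (\<lambda>i. ?q ! (i + 1) - ?q ! i) [0..<length p]
      = map (\<lambda>i. (1 # p) ! (i + 1) - (1 # p) ! i) [0..<length p]"
    by (rule map_cong) (auto simp: nth_Cons')
  finally have diffs: "map (\<lambda>i. (1 # ?q) ! (i + 1) - (1 # ?q) ! i) [0..<Suc (length p)]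
      = ?k # map (\<lambda>i. (1 # p) ! (i + 1) - (1 # p) ! i) [0..<length p]" .
  have "last (1 # ?q) = last (1 # p) + ?k"
    by (simp add: last_map)
  then have "length (s # v @ s # r) - last (1 # ?q) = length (s # r) - last (1 # p)"
    by simp
  with diffs show ?thesis
    unfolding distinguished_symbol_rule_def Let_def symbol_positions_return[OF assms] p
    by (simp del: upt_Suc list.map)
qed

text \<open>Case split behind the recursion over blocks: the letters after an initial
  \<open>s\<close> either finish the last block or reach the next \<open>s\<close>.\<close>

lemma first_return:
  obtains (none) "s \<notin> set w"
  | (return) v r where "s \<notin> set v" "w = v @ s # r"
  by (metis split_list_first)

text \<open>Blocks are stripped by induction on length; a block followed by another \<open>s\<close>
  is a return block. The last block may be incomplete, and irreducibility extends it to a return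
  block, which bounds its length.\<close>

lemma rule_of_word:
  assumes "vertex_shift X" "irreducible_shift X" "s # w \<in> lang X"
    and "c = distinguished_symbol_rule (s # w)"
  shows "c \<noteq> [] \<and> (\<forall>k \<in> set c. 0 < k) \<and> sum_list c = Suc (length w) \<and>
    set (butlast c) \<subseteq> return_lengths X s \<and> (\<exists>k' \<in> return_lengths X s. last c \<le> k')"
  using assms(3,4)
proof (induction w arbitrary: c rule: length_induct)
  case (1 w)
  show ?case
  proof (cases s w rule: first_return)
    case none
    have "[s] \<in> lang X"
      using lang_prefix[OF assms(1), of "[s]" w] 1 by simp
    then obtain v where v: "(s # w) @ v @ [s] \<in> lang X"
      using assms(2) 1 unfolding irreducible_shift_def by blast
    \<comment> \<open>Stopping at the first \<open>s\<close> after the block keeps the completed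
      block free of inner occurrences of \<open>s\<close>; the appended \<open>[s]\<close>
      guarantees that there is one.\<close>
    obtain v' r where v': "s \<notin> set v'" "v @ [s] = v' @ s # r"
      by (metis first_return in_set_conv_decomp)
    then have "s # (w @ v') @ [s] \<in> lang X"
      using lang_prefix[OF assms(1), of "s # (w @ v') @ [s]" r] v by simp
    then have "Suc (length (w @ v')) \<in> return_lengths X s"
      unfolding return_lengths_iff using none v'(1) by (intro exI[of _ "w @ v'"]) auto
    then show ?thesis
      using 1 none by (auto simp: rule_no_return intro!: bexI[of _ "Suc (length (w @ v'))"])
  next
    case (return v r)
    define d where "d = distinguished_symbol_rule (s # r)"
    have c: "c = Suc (length v) # d"
      using 1 return by (simp add: rule_return d_def)
    have r: "s # r \<in> lang X"
      using lang_suffix[OF assms(1), of "s # v" "s # r"] 1 return by simp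
    have "s # v @ [s] \<in> lang X"
      using lang_prefix[OF assms(1), of "s # v @ [s]" r] 1 return by simp
    then have k: "Suc (length v) \<in> return_lengths X s"
      using return(1) by (auto simp: return_lengths_iff)
    have "length r < length w"
      using return by simp
    with r have "d \<noteq> [] \<and> (\<forall>k \<in> set d. 0 < k) \<and> sum_list d = Suc (length r) \<and>
        set (butlast d) \<subseteq> return_lengths X s \<and> (\<exists>k' \<in> return_lengths X s. last d \<le> k')"
      using "1.IH" d_def by blast
    with k return(2) show ?thesis
      by (simp add: c)
  qed
qed

text \<open>All summands but the last are realized by full return blocks, glued at \<open>s\<close>
  by \<open>lang_splice\<close>; the last one is realized by an initial part of a sufficiently long
  return block.\<close>

lemma word_of_rule:
  assumes "vertex_shift X" "c \<noteq> []" "\<forall>k \<in> set c. 0 < k"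
    and "set (butlast c) \<subseteq> return_lengths X s" "\<exists>k' \<in> return_lengths X s. last c \<le> k'"
  shows "\<exists>w. s # w \<in> lang X \<and> Suc (length w) = sum_list c \<and> distinguished_symbol_rule (s # w) = c"
  using assms(2-)
proof (induction c rule: list_nonempty_induct)
  case (single k)
  then obtain k' where "k' \<in> return_lengths X s" "k \<le> k'" "0 < k"
    by auto
  then obtain v where v: "s \<notin> set v" "k \<le> Suc (length v)" "s # v @ [s] \<in> lang X"
    by (auto simp: return_lengths_iff)
  \<comment> \<open>With the leading \<open>s\<close> this prefix has exactly \<open>k\<close>
    letters, since \<open>0 < k\<close> and \<open>k \<le> Suc (length v)\<close>.\<close>
  have "s # take (k - 1) v \<in> lang X"
    using lang_prefix[OF assms(1), of "s # take (k - 1) v" "drop (k - 1) v @ [s]"] v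
    by (simp flip: append_assoc)
  moreover have "s \<notin> set (take (k - 1) v)"
    using v by (meson in_set_takeD)
  ultimately show ?case
    using v \<open>0 < k\<close> by (auto simp: rule_no_return intro!: exI[of _ "take (k - 1) v"])
next
  case (cons k c)
  then have "k \<in> return_lengths X s"
    by simp
  then obtain v where v: "s \<notin> set v" "k = Suc (length v)" "s # v @ [s] \<in> lang X"
    by (auto simp: return_lengths_iff)
  obtain w where w: "s # w \<in> lang X" "Suc (length w) = sum_list c"
    "distinguished_symbol_rule (s # w) = c"
    using cons by auto
  have "s # v @ s # w \<in> lang X"
    using lang_splice[OF assms(1), of "s # v" s w] v w by simp
  then show ?case
    using v w by (intro exI[of _ "v @ s # w"]) (simp add: rule_return)
qed

lemma rule_image:
  assumes "vertex_shift X" "irreducible_shift X"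
  shows "distinguished_symbol_rule ` lang_from X s n =
    {c \<in> compositions n. c \<noteq> [] \<and> set (butlast c) \<subseteq> return_lengths X s \<and>
      (\<exists>k' \<in> return_lengths X s. last c \<le> k')}" (is "?L = ?R")
proof
  have lf: "lang_from X s n = {s # w | w. s # w \<in> lang X \<and> Suc (length w) = n}"
  proof -
    have "w \<in> lang_from X s n \<longleftrightarrow> (\<exists>w'. w = s # w' \<and> s # w' \<in> lang X \<and> Suc (length w') = n)" for w
      by (cases w) (auto simp: lang_from_def lang_n_eq)
    then show ?thesis
      by blast
  qed
  show "?L \<subseteq> ?R"
    using rule_of_word[OF assms] by (fastforce simp: lf compositions_def)
  show "?R \<subseteq> ?L"
  proof
    fix c assume "c \<in> ?R"
    then obtain w where "s # w \<in> lang X" "Suc (length w) = n" "distinguished_symbol_rule (s # w) = c"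
      using word_of_rule[OF assms(1), of c s] by (auto simp: compositions_def)
    then show "c \<in> ?L"
      unfolding lf by blast
  qed
qed

text \<open>A last summand bounded by an element of \<open>K\<close> either is in \<open>K\<close>
  or lies strictly below that element, which gives the two classes. For \<open>n = 0\<close> the
  empty composition is over \<open>K\<close> but not in the image.\<close>

lemma rule_image_decomp:
  assumes "vertex_shift X" "irreducible_shift X" "K = return_lengths X s" "n \<ge> 1"
  shows "distinguished_symbol_rule ` lang_from X s n =
    {c \<in> compositions n. set c \<subseteq> K} \<union> defect_n K n"
proof -
  have "c \<noteq> [] \<and> set (butlast c) \<subseteq> K \<and> (\<exists>k' \<in> K. last c \<le> k') \<longleftrightarrow>
      set c \<subseteq> K \<or> c \<in> defect_class K" if "c \<in> compositions n" for c
  proof -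
    have "c \<noteq> []"
      using that \<open>n \<ge> 1\<close> by (auto simp: compositions_def)
    then obtain b l where c: "c = b @ [l]"
      by (metis append_butlast_last_id)
    have pos: "\<forall>k \<in> set c. 0 < k"
      using that by (simp add: compositions_def)
    have "(\<exists>k'\<in>K. l \<le> k') \<longleftrightarrow> l \<in> K \<or> (l \<notin> K \<and> (\<exists>k'\<in>K. l < k'))"
      using le_neq_implies_less by (metis less_imp_le order_refl)
    then show ?thesis
      using pos by (auto simp: c defect_class_def pos_compl_def)
  qed
  then show ?thesis
    unfolding rule_image[OF assms(1,2)] assms(3)[symmetric] defect_n_def by blast
qed

section \<open>Decomposition of the dimensions\<close>

text \<open>Rotations keep the set of summands, which contains the last one, outside
  \<open>K\<close>. This separates the orbits of the two classes.\<close>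

lemma cyclic_orbit_defect_not_subset:
  assumes "c \<in> defect_class K" "d \<in> cyclic_orbit c"
  shows "\<not> set d \<subseteq> K"
  using set_of_cyclic_orbit[OF assms(2)] defect_class_snoc[OF assms(1)]
  by (metis in_set_conv_decomp subsetD)

text \<open>All members of a wheel have the same summands, so the condition may be tested on one
  representative.\<close>

lemma num_wheels_eq: "num_wheels K n = card (cyclic_orbit ` {c \<in> compositions n. set c \<subseteq> K})"
proof -
  have "{W \<in> wheels n. \<forall>c \<in> W. set c \<subseteq> K} = cyclic_orbit ` {c \<in> compositions n. set c \<subseteq> K}"
    using set_of_cyclic_orbit self_in_cyclic_orbit by (fastforce simp: wheels_def)
  then show ?thesis by (simp add: num_wheels_def)
qed

lemma dim_T_decomp:
  "dim_T ({c \<in> compositions n. set c \<subseteq> K} \<union> defect_n K n) = num_wheels K n + card (defect_n K n)"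
proof -
  let ?A = "{c \<in> compositions n. set c \<subseteq> K}"
  have "cyclic_orbit a \<noteq> cyclic_orbit d" if "a \<in> ?A" "d \<in> defect_n K n" for a d
    using cyclic_orbit_defect_not_subset[of d K a] that self_in_cyclic_orbit[of a]
    by (auto simp: defect_n_def)
  then have "card (cyclic_orbit ` (?A \<union> defect_n K n))
      = card (cyclic_orbit ` ?A) + card (cyclic_orbit ` defect_n K n)"
    unfolding image_Un
    by (intro card_Un_disjoint) (auto simp: finite_compositions finite_defect_n)
  moreover have "card (cyclic_orbit ` defect_n K n) = card (defect_n K n)"
    using inj_on_cyclic_orbit_defect_class
    by (metis card_image defect_n_def inf_le1 inj_on_subset)
  ultimately show ?thesis
    by (simp add: dim_T_eq_card_orbits num_wheels_eq)
qed

text \<open>The compositions of \<open>n\<close> over \<open>K\<close> are closed under rotation, so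
  this class is its own union of orbits and contributes its cardinality.\<close>

lemma dim_O_decomp:
  "dim_O ({c \<in> compositions n. set c \<subseteq> K} \<union> defect_n K n)
    = num_compositions K n + dim_O (defect_n K n)"
proof -
  let ?A = "{c \<in> compositions n. set c \<subseteq> K}" and ?D = "\<Union>d \<in> defect_n K n. cyclic_orbit d"
  have "cyclic_orbit c \<subseteq> ?A" if "c \<in> ?A" for c
    using that cyclic_orbit_subset_compositions[of c n] set_of_cyclic_orbit[of _ c] by auto
  then have "(\<Union>c \<in> ?A. cyclic_orbit c) = ?A"
    using self_in_cyclic_orbit by fast
  moreover have "?A \<inter> ?D = {}"
    using cyclic_orbit_defect_not_subset by (fastforce simp: defect_n_def)
  ultimately show ?thesis
    unfolding dim_O_def num_compositions_def UN_Un
    by (simp add: card_Un_disjoint finite_compositions finite_defect_n finite_cyclic_orbit)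
qed

theorem theorem1:
  fixes X :: "(int \<Rightarrow> 'a::countable) set" and s :: 'a and K :: "nat set"
  assumes "vertex_shift X" and "irreducible_shift X"
    and "K = return_lengths X s"
  shows "transversal_gf X s = wheel_gf K + defect_gf K
    \<and> orbital_gf X s = composition_gf K + defect_orbital_gf K
    \<and> (\<forall>c \<in> defect_class K. aperiodic c)
    \<and> (\<forall>n \<ge> 1. fps_nth (defect_gf K) n =
         int (\<Sum>k | k \<in> pos_compl K \<and> k \<le> n \<and> (\<exists>k' \<in> K. k < k'). num_compositions K (n - k)))
    \<and> defect_orbital_gf K = deriv_u_at_1 (defect_gf2 K)"
proof (intro conjI)
  show "transversal_gf X s = wheel_gf K + defect_gf K"
    by (rule fps_ext)
      (simp add: transversal_gf_def wheel_gf_def defect_gf_def rule_image_decomp[OF assms]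
        dim_T_decomp Suc_le_eq)
  \<comment> \<open>The constant term 1 of \<open>orbital_gf\<close> is matched by the empty
    composition.\<close>
  have "{c \<in> compositions 0. set c \<subseteq> K} = {[]}"
    by (auto simp: compositions_def) (metis gr_implies_not0 list.set_intros(1) neq_Nil_conv)
  then have "num_compositions K 0 = 1"
    by (simp add: num_compositions_def)
  then show "orbital_gf X s = composition_gf K + defect_orbital_gf K"
    by (intro fps_ext)
      (simp add: orbital_gf_def composition_gf_def defect_orbital_gf_def rule_image_decomp[OF assms]
        dim_O_decomp Suc_le_eq)
  show "\<forall>c \<in> defect_class K. aperiodic c"
    using aperiodic_defect_class by blast
  show "\<forall>n \<ge> 1. fps_nth (defect_gf K) n =
      int (\<Sum>k | k \<in> pos_compl K \<and> k \<le> n \<and> (\<exists>k' \<in> K. k < k'). num_compositions K (n - k))"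
    by (simp add: defect_gf_def card_defect_n)
  show "defect_orbital_gf K = deriv_u_at_1 (defect_gf2 K)"
    by (rule defect_orbital_gf_eq_deriv)
qed

end
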